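(* Let $n$ and $k$ be positive integers. The equation $(k!)^n+k^{n!}=(n!)^k+n^{k!}$ holds if and only if $k=n$. *)

theory Defs
  imports Complex_Main
begin

end

theory Submission
  imports Defs
begin

text \<open>
  Let \<open>k < n\<close> and \<open>M = (n - 1)!\<close>. For \<open>k \<ge> 2\<close> the term \<open>k ^ n!\<close> dominates: \<open>k ^ n \<ge> 2 * n\<close> gives
  \<open>k ^ n! = (k ^ n) ^ M \<ge> 2 ^ M * n ^ M > 2 * n ^ M\<close>. If \<open>n \<ge> 5\<close> then \<open>(n - 1)\<^sup>2 \<le> M\<close>, so
  both \<open>(n!) ^ k \<le> n ^ ((n - 1) * k)\<close> and \<open>n ^ k!\<close> are at most \<open>n ^ M\<close>. The cases \<open>n = 3, 4\<close> are
  numerical, and for \<open>k = 1\<close> the equation reads \<open>2 = n! + n\<close>.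
\<close>

text \<open>Each of the \<open>m\<close> factors 2, ..., \<open>Suc m\<close> is at most
  \<open>Suc m\<close>; leaving out the factor 1 keeps the exponent at \<open>m\<close>.\<close>

lemma fact_Suc_le_power: "(fact (Suc m) :: nat) \<le> Suc m ^ m"
proof (induction m)
  case (Suc m)
  have "fact (Suc (Suc m)) = Suc (Suc m) * (fact (Suc m) :: nat)"
    by simp
  also have "\<dots> \<le> Suc (Suc m) * Suc (Suc m) ^ m"
    using Suc.IH power_mono[of "Suc m" "Suc (Suc m)" m] by (intro mult_le_mono2) linarith
  finally show ?case
    by simp
qed simp

text \<open>The bound fails at 3, as 9 > 6; hence the threshold \<open>5 \<le> n\<close> below,
  where this is used at \<open>n - 1\<close>.\<close>

lemma square_le_fact:
  fixes m :: nat
  assumes "4 \<le> m"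
  shows "m * m \<le> fact m"
  using assms
proof (induction m rule: dec_induct)
  case base
  show ?case by (simp add: fact_numeral)
next
  case (step m)
  have "Suc m \<le> m * m"
    using step.hyps mult_le_mono1[of 2 m m] by linarith
  with step.IH have "Suc m \<le> fact m"
    by linarith
  then have "Suc m * Suc m \<le> Suc m * fact m"
    by (rule mult_le_mono2)
  then show ?case
    by simp
qed

lemma double_le_two_power: "1 \<le> n \<Longrightarrow> 2 * n \<le> (2 :: nat) ^ n"
  by (induction n rule: dec_induct) auto

lemma power_fact_dominates:
  fixes n k :: nat
  assumes "2 \<le> k" "k < n" "5 \<le> n"
  shows "(fact n :: nat) ^ k + n ^ fact k < k ^ fact n"
proof -
  obtain m where n: "n = Suc m"
    using assms by (cases n) auto
  define M :: nat where "M = fact m"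
  have km: "k \<le> m" and m: "4 \<le> m"
    using assms n by auto
  have mM: "m * m \<le> M"
    unfolding M_def using m by (rule square_le_fact)
  have "(fact n :: nat) ^ k \<le> (n ^ m) ^ k"
    unfolding n by (intro power_mono fact_Suc_le_power) simp
  also have "\<dots> = n ^ (m * k)"
    by (simp add: power_mult)
  also have "\<dots> \<le> n ^ M"
    using mM mult_le_mono2[OF km, of m] n by (intro power_increasing) linarith+
  finally have *: "(fact n :: nat) ^ k \<le> n ^ M" .
  have **: "n ^ fact k \<le> n ^ M"
    unfolding M_def using km n by (intro power_increasing fact_mono) auto
  have "1 < M"
    using mM mult_le_mono[OF m m] by linarith
  then have "(2 :: nat) ^ 1 < 2 ^ M"
    by (intro power_strict_increasing) auto
  then have "2 * n ^ M < 2 ^ M * n ^ M"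
    using n by (intro mult_strict_right_mono) auto
  also have "\<dots> = (2 * n) ^ M"
    by (simp add: power_mult_distrib)
  also have "\<dots> \<le> (k ^ n) ^ M"
    using double_le_two_power[of n] power_mono[of 2 k n] assms
    by (intro power_mono) linarith+
  also have "\<dots> = k ^ fact n"
    by (simp add: n M_def flip: power_mult power_Suc)
  finally show ?thesis
    using * ** by linarith
qed

lemma fact_power_sum_neq:
  fixes n k :: nat
  assumes "0 < k" "k < n"
  shows "(fact k :: nat) ^ n + k ^ fact n \<noteq> (fact n :: nat) ^ k + n ^ fact k"
proof -
  consider "k = 1" | "2 \<le> k" "5 \<le> n" | "k = 2" "n = 3" | "k = 2" "n = 4" | "k = 3" "n = 4"
    using assms by linarith
  then show ?thesis
  proof cases
    case 1
    have "1 \<le> (fact n :: nat)"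
      by (rule fact_ge_1)
    with 1 assms have "2 < fact n + n"
      by linarith
    with 1 show ?thesis
      by simp
  next
    case 2
    then show ?thesis
      using power_fact_dominates[of k n] assms by linarith
  qed (simp_all add: fact_numeral)
qed

theorem theorem1p4:
  fixes n k :: nat
  assumes "n > 0" and "k > 0"
  shows "(fact k :: nat) ^ n + k ^ (fact n) = (fact n :: nat) ^ k + n ^ (fact k) \<longleftrightarrow> k = n"
  \<comment> \<open>Swapping \<open>k\<close> and \<open>n\<close> exchanges the two sides of the
    equation, so both strict orders are excluded.\<close>
  using fact_power_sum_neq[of k n] fact_power_sum_neq[of n k] assms
  by (metis linorder_neqE_nat)

end
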